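(* Every functionally countable Tychonoff space $X$ is a $CZ$-space.
   Context: All topological spaces are Tychonoff. A space $X$ is functionally countable if every second countable continuous image of $X$ is countable. A subset $A\subseteq X$ is a zero-set if $A=f^{-1}(0)$ for some continuous $f:X\to\mathbb{R}$; a cozero-set is the complement of a zero-set. A $Zer_\sigma$-set is a countable union of zero-sets, and a $Coz_\delta$-set is a countable intersection of cozero-sets. $X$ is a $CZ$-space if every $Zer_\sigma$-set of $X$ is a $Coz_\delta$-set. *)

theory Defs
  imports "HOL-Analysis.Analysis"
begin

definition tychonoff_space :: "'a topology \<Rightarrow> bool" where
  "tychonoff_space X \<longleftrightarrow> completely_regular_space X \<and> t1_space X"

text \<open>
  HOL does not allow the definition below to quantify over the carrier type of the image \<open>Y\<close>.
  This is harmless: choosing a point in each fibre shows that every continuous image of \<open>X\<close> is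
  homeomorphic to a topology on a subset of \<open>topspace X\<close>, hence to one with carrier type \<open>'a\<close>.
  Lemma \<open>functionally_countable_image\<close> gives the property for images of arbitrary type.
  The images are Tychonoff because all spaces under consideration are.
\<close>

definition functionally_countable :: "'a topology \<Rightarrow> bool" where
  "functionally_countable X \<longleftrightarrow>
     (\<forall>(Y :: 'a topology) f.
        tychonoff_space Y \<and> second_countable Y \<and>
        continuous_map X Y f \<and> f ` topspace X = topspace Y \<longrightarrow>
        countable (topspace Y))"

lemma homeomorphic_tychonoff_space:
  assumes "X homeomorphic_space Y"
  shows "tychonoff_space X \<longleftrightarrow> tychonoff_space Y"
  using assms unfolding tychonoff_space_def
  by (simp add: homeomorphic_completely_regular_space homeomorphic_t1_space)

lemma functionally_countable_image:
  fixes X :: "'a topology" and Y :: "'b topology"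
  assumes fc: "functionally_countable X"
    and Y: "tychonoff_space Y" "second_countable Y"
    and f: "continuous_map X Y f" "f ` topspace X = topspace Y"
  shows "countable (topspace Y)"
proof -
  define g where "g = inv_into (topspace X) f"
  define Y' where "Y' = pullback_topology (g ` topspace Y) f Y"
  have fg: "f (g y) = y" if "y \<in> topspace Y" for y
    using that f(2) by (simp add: g_def f_inv_into_f)
  have top: "topspace Y' = g ` topspace Y"
    using fg by (auto simp: Y'_def topspace_pullback_topology)
  have cf: "continuous_map Y' Y f"
    using continuous_map_pullback[OF continuous_map_id[of Y], where A = "g ` topspace Y" and f = f]
    by (simp add: Y'_def)
  have cg: "continuous_map Y Y' g"
    unfolding Y'_def
  proof (rule continuous_map_pullback')
    show "continuous_map Y Y (f \<circ> g)"
      by (rule continuous_map_eq[OF continuous_map_id]) (simp add: fg)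
  qed auto
  have hom: "homeomorphic_maps Y Y' g f"
    using cf cg fg top by (auto simp: homeomorphic_maps_def)
  then have hs: "Y homeomorphic_space Y'"
    by (auto simp: homeomorphic_space_def)
  have "tychonoff_space Y'" "second_countable Y'"
    using Y hs homeomorphic_tychonoff_space homeomorphic_space_second_countability by blast+
  moreover have "continuous_map X Y' (g \<circ> f)"
    using f(1) cg by (rule continuous_map_compose)
  moreover have "(g \<circ> f) ` topspace X = topspace Y'"
    by (simp only: image_comp[symmetric] f(2) top)
  ultimately have "countable (topspace Y')"
    using fc unfolding functionally_countable_def by blast
  moreover have "topspace Y = f ` topspace Y'"
    using fg by (force simp: top)
  ultimately show ?thesis
    by simp
qed

definition zero_set_in :: "'a topology \<Rightarrow> 'a set \<Rightarrow> bool" where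
  "zero_set_in X A \<longleftrightarrow>
     (\<exists>f. continuous_map X euclideanreal f \<and> A = {x \<in> topspace X. f x = 0})"

definition cozero_set_in :: "'a topology \<Rightarrow> 'a set \<Rightarrow> bool" where
  "cozero_set_in X A \<longleftrightarrow> (\<exists>Z. zero_set_in X Z \<and> A = topspace X - Z)"

text \<open>As in \<^const>\<open>gdelta_in\<close>, \<open>relative_to\<close> makes the empty intersection \<open>topspace X\<close>.\<close>

definition zer_sigma_in :: "'a topology \<Rightarrow> 'a set \<Rightarrow> bool" where
  "zer_sigma_in X = countable union_of zero_set_in X"

definition coz_delta_in :: "'a topology \<Rightarrow> 'a set \<Rightarrow> bool" where
  "coz_delta_in X = (countable intersection_of cozero_set_in X) relative_to topspace X"

definition cz_space :: "'a topology \<Rightarrow> bool" where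
  "cz_space X \<longleftrightarrow> (\<forall>A. zer_sigma_in X A \<longrightarrow> coz_delta_in X A)"

end

theory Submission
  imports Defs
begin

text \<open>
  A sequence of continuous functions defining the zero-sets maps \<open>X\<close> onto a subspace of
  \<open>\<real>\<^sup>\<nat>\<close>, which is countable since \<open>X\<close> is functionally countable. Hence the
  complement of the union of these zero-sets is a countable union of fibres, and a fibre over \<open>y\<close>
  is itself a zero-set, namely that of the distance to \<open>y\<close>.
\<close>

text \<open>The range, as a subspace of a second countable metric space, is second countable and,
  being metrizable, Tychonoff. Its carrier type is \<open>'b\<close>, so
  \<open>functionally_countable_image\<close> is needed rather than the bare definition.\<close>

lemma functionally_countable_image_countable:
  fixes F :: "'a \<Rightarrow> 'b::{metric_space,second_countable_topology}"
  assumes "functionally_countable X" and F: "continuous_map X euclidean F"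
  shows "countable (F ` topspace X)"
proof -
  let ?Y = "subtopology euclidean (F ` topspace X)"
  have "metrizable_space ?Y"
    by (simp add: metrizable_space_euclidean metrizable_space_subtopology)
  then have "tychonoff_space ?Y"
    unfolding tychonoff_space_def
    by (simp add: metrizable_imp_completely_regular_space metrizable_imp_t1_space)
  moreover have "second_countable (euclidean :: 'b topology)"
  proof -
    obtain \<B> :: "'b set set" where "countable \<B>" "topological_basis \<B>"
      using ex_countable_basis by blast
    moreover from \<open>topological_basis \<B>\<close> have "\<exists>V\<in>\<B>. x \<in> V \<and> V \<subseteq> U" if "open U" "x \<in> U" for U x
      using that by (rule topological_basisE) blast
    ultimately show ?thesis
      unfolding second_countable_def
      by (intro exI[of _ \<B>]) (simp add: topological_basis_open)
  qed
  then have "second_countable ?Y"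
    by (rule second_countable_subtopology)
  moreover have "continuous_map X ?Y F"
    using F by (simp add: continuous_map_in_subtopology)
  ultimately show ?thesis
    using functionally_countable_image[OF assms(1), of ?Y F] by simp
qed

lemma zero_set_in_fibre:
  fixes F :: "'a \<Rightarrow> 'b::metric_space"
  assumes "continuous_map X euclidean F"
  shows "zero_set_in X {x \<in> topspace X. F x = y}"
proof -
  have "continuous_map euclidean euclideanreal (\<lambda>z. dist z y)"
    by (simp add: continuous_on_dist)
  with assms have "continuous_map X euclideanreal ((\<lambda>z. dist z y) \<circ> F)"
    by (rule continuous_map_compose)
  then show ?thesis
    unfolding zero_set_in_def by (intro exI[of _ "(\<lambda>z. dist z y) \<circ> F"]) simp
qed

theorem theorem2p8:
  fixes X :: "'a topology"
  assumes "tychonoff_space X"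
    and "functionally_countable X"
  shows "cz_space X"
  unfolding cz_space_def
proof (intro allI impI)
  fix A assume "zer_sigma_in X A"
  then obtain \<U> where \<U>: "countable \<U>" "\<And>Z. Z \<in> \<U> \<Longrightarrow> zero_set_in X Z" "A = \<Union>\<U>"
    unfolding zer_sigma_in_def union_of_def by blast
  \<comment> \<open>Adding \<open>{}\<close> leaves the union unchanged and makes the family
    nonempty, so that it can be enumerated by all of \<open>nat\<close> even when
    \<open>\<U>\<close> is empty or finite.\<close>
  have "zero_set_in X {}"
    unfolding zero_set_in_def by (rule exI[of _ "\<lambda>_. 1"]) simp
  then have zero: "zero_set_in X Z" if "Z \<in> insert {} \<U>" for Z
    using that \<U>(2) by blast
  define Z where "Z = from_nat_into (insert {} \<U>)"
  have Z: "range Z = insert {} \<U>"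
    unfolding Z_def by (rule range_from_nat_into) (simp_all add: \<U>(1))
  then have "\<forall>n. \<exists>f. continuous_map X euclideanreal f \<and> Z n = {x \<in> topspace X. f x = 0}"
    using zero unfolding zero_set_in_def by (metis rangeI)
  then obtain f where f: "\<And>n. continuous_map X euclideanreal (f n)"
      "\<And>n. Z n = {x \<in> topspace X. f n x = 0}"
    by metis
  \<comment> \<open>The diagonal map into \<open>nat \<Rightarrow> real\<close>, whose product
    topology is metrizable and second countable.\<close>
  define F where "F x n = f n x" for x and n :: nat
  have F: "continuous_map X euclidean F"
    unfolding euclidean_product_topology[symmetric] continuous_map_componentwise
    by (simp add: F_def f(1))
  have A: "A = {x \<in> topspace X. \<exists>n. F x n = 0}"
  proof -
    have "A = \<Union>(range Z)"
      by (simp add: Z \<U>(3))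
    then show ?thesis
      by (auto simp: f(2) F_def)
  qed
  \<comment> \<open>Membership of \<open>x\<close> in \<open>A\<close> depends only on
    \<open>F x\<close>, so the fibres over \<open>B\<close> partition the complement of
    \<open>A\<close>.\<close>
  define B where "B = {y \<in> F ` topspace X. \<forall>n. y n \<noteq> 0}"
  have "countable B"
    using functionally_countable_image_countable[OF assms(2) F]
    by (rule countable_subset[rotated]) (auto simp: B_def)
  define \<V> where "\<V> = (\<lambda>y. topspace X - {x \<in> topspace X. F x = y}) ` B"
  have "countable \<V>"
    using \<open>countable B\<close> by (simp add: \<V>_def)
  moreover have "\<V> \<subseteq> Collect (cozero_set_in X)"
    unfolding \<V>_def cozero_set_in_def using zero_set_in_fibre[OF F] by blast
  \<comment> \<open>A point outside \<open>A\<close> is removed by the member of \<open>\<V>\<close>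
    for \<open>y = F x\<close>. If \<open>B\<close> is empty, then \<open>\<Inter>\<V>\<close> is
    \<open>UNIV\<close> and \<open>A\<close> is the whole space.\<close>
  moreover have "topspace X \<inter> \<Inter>\<V> = A"
    by (auto simp: A \<V>_def B_def)
  ultimately show "coz_delta_in X A"
    unfolding coz_delta_in_def relative_to_def intersection_of_def
    by (intro exI[of _ "\<Inter>\<V>"] conjI exI[of _ \<V>]) simp_all
qed

end
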